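(* Let $a,b,c,\alpha,\beta,\gamma$ be integers with $0\le\alpha<a$, $0\le\beta<b$, $0\le\gamma<c$ and at most one of $\alpha,\beta,\gamma$ zero. Suppose $a+b+c+\alpha+\beta+\gamma\equiv 0\pmod 3$, put $s=\frac13(a+b+c+\alpha+\beta+\gamma)-2$, $A=s+2-a$, $B=s+2-b$, $C=s+2-c$, $M=s+2-(\alpha+\beta+\gamma)$, and assume $0\le M$, $0\le A\le\beta+\gamma$, $0\le B\le\alpha+\gamma$, $0\le C\le\alpha+\beta$. If $a+b+c=2(\alpha+\beta+\gamma)$, then $M=0$ and $$\det N_{a,b,c,\alpha,\beta,\gamma}=\operatorname{Mac}(A,B,C).$$ Thus, for an infinite field $K$, the algebra $K[x,y,z]/(x^a,y^b,z^c,x^\alpha y^\beta z^\gamma)$ has the weak Lefschetz property if the characteristic of $K$ is zero or at least $A+B+C=\alpha+\beta+\gamma=\frac12(a+b+c)$.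
   Context: For non-negative integers, $\operatorname{Mac}(p,q,r):=\dfrac{\mathcal H(p)\mathcal H(q)\mathcal H(r)\mathcal H(p+q+r)}{\mathcal H(p+q)\mathcal H(p+r)\mathcal H(q+r)}$, where $\mathcal H(n):=\prod_{i=0}^{n-1}i!$ is the hyperfactorial. $N_{a,b,c,\alpha,\beta,\gamma}$ is the $(C+M)\times(C+M)$ integer matrix with $(i,j)$ entry $\binom{c}{A+j-i}$ if $1\le i\le C$ and $\binom{\gamma}{A+C-\beta+j-i}$ if $C+1\le i\le C+M$, where $\binom nk=0$ if $k<0$ or $k>n$ (determinant of the empty matrix is $1$). An artinian standard graded $K$-algebra $Q$ has the weak Lefschetz property if there is a linear form $\ell\in[Q]_1$ such that for all integers $d$ the map $\times\ell:[Q]_d\to[Q]_{d+1}$ is injective or surjective. *)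

theory Defs
  imports
    "HOL-Library.Poly_Mapping"
    "HOL-Library.Product_Plus"
    "HOL-Algebra.QuotRing"
    "HOL-Algebra.Algebraic_Closure_Type"
    "Jordan_Normal_Form.Determinant"
begin

definition hyperfactorial :: "nat \<Rightarrow> nat" where
  "hyperfactorial n = (\<Prod>i<n. fact i)"

definition Mac :: "nat \<Rightarrow> nat \<Rightarrow> nat \<Rightarrow> rat" where
  "Mac p q r =
     of_nat (hyperfactorial p * hyperfactorial q * hyperfactorial r * hyperfactorial (p + q + r)) /
     of_nat (hyperfactorial (p + q) * hyperfactorial (p + r) * hyperfactorial (q + r))"

text \<open>Binomial coefficient with integer arguments, used for \<open>n \<ge> 0\<close> only. The case \<open>k > n\<close>
  is covered by the convention of \<^term>\<open>(choose)\<close>.\<close>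

definition binom :: "int \<Rightarrow> int \<Rightarrow> int" where
  "binom n k = (if k < 0 then 0 else int (nat n choose nat k))"

text \<open>Matrix indices start at 0 here, so the rows \<open>1 \<le> i \<le> C\<close> become \<open>i < C\<close>, while the
  difference \<open>j - i\<close> is unaffected.\<close>

definition N_mat :: "int \<Rightarrow> int \<Rightarrow> int \<Rightarrow> int \<Rightarrow> int \<Rightarrow> int \<Rightarrow> int mat" where
  "N_mat a b c \<alpha> \<beta> \<gamma> =
     (let s = (a + b + c + \<alpha> + \<beta> + \<gamma>) div 3 - 2;
          A = s + 2 - a;
          C = s + 2 - c;
          M = s + 2 - (\<alpha> + \<beta> + \<gamma>)
      in mat (nat (C + M)) (nat (C + M))
           (\<lambda>(i, j). if int i < C then binom c (A + int j - int i)
                     else binom \<gamma> (A + C - \<beta> + int j - int i)))"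

text \<open>The polynomial ring \<open>K[x,y,z]\<close> is the monoid algebra of \<open>\<nat>\<^sup>3\<close>: the exponent \<open>(i, j, k)\<close>
  stands for the monomial \<open>x\<^sup>i y\<^sup>j z\<^sup>k\<close>.\<close>

type_synonym 'k poly3 = "(nat \<times> nat \<times> nat) \<Rightarrow>\<^sub>0 'k"

definition var_x :: "'k::field poly3" where "var_x = Poly_Mapping.single (1, 0, 0) 1"
definition var_y :: "'k::field poly3" where "var_y = Poly_Mapping.single (0, 1, 0) 1"
definition var_z :: "'k::field poly3" where "var_z = Poly_Mapping.single (0, 0, 1) 1"

abbreviation poly3_ring :: "'k::field poly3 ring" where
  "poly3_ring \<equiv> ring_of_type_algebra"

text \<open>Degrees range over \<^typ>\<open>int\<close>; the components of negative degree are zero.\<close>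

definition homogeneous_poly3 :: "int \<Rightarrow> 'k::field poly3 set" where
  "homogeneous_poly3 d = {f. \<forall>(i, j, k)\<in>Poly_Mapping.keys f. int (i + j + k) = d}"

definition quot_component :: "'k::field poly3 set \<Rightarrow> int \<Rightarrow> 'k poly3 set set" where
  "quot_component I d = (\<lambda>f. I +>\<^bsub>poly3_ring\<^esub> f) ` homogeneous_poly3 d"

text \<open>The weak Lefschetz property of a ring \<open>Q\<close> whose graded components are \<open>H d\<close>. It is meant
  for artinian standard graded algebras over a field; the base field enters only through the
  components.\<close>

definition weak_lefschetz :: "('q, 'm) ring_scheme \<Rightarrow> (int \<Rightarrow> 'q set) \<Rightarrow> bool" where
  "weak_lefschetz Q H \<longleftrightarrow>
     (\<exists>l\<in>H 1. \<forall>d. inj_on (\<lambda>f. l \<otimes>\<^bsub>Q\<^esub> f) (H d) \<or>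
                      (\<lambda>f. l \<otimes>\<^bsub>Q\<^esub> f) ` H d = H (d + 1))"

definition almost_ci_ideal :: "nat \<Rightarrow> nat \<Rightarrow> nat \<Rightarrow> nat \<Rightarrow> nat \<Rightarrow> nat \<Rightarrow> 'k::field poly3 set" where
  "almost_ci_ideal a b c \<alpha> \<beta> \<gamma> =
     Idl\<^bsub>poly3_ring\<^esub> {var_x ^ a, var_y ^ b, var_z ^ c, var_x ^ \<alpha> * var_y ^ \<beta> * var_z ^ \<gamma>}"

end

theory Submission
  imports Defs
begin

text \<open>Put \<open>\<sigma> = \<alpha> + \<beta> + \<gamma>\<close>. The hypotheses give \<open>s = \<sigma> - 2\<close>, hence \<open>M = 0\<close>, \<open>A + B + C = \<sigma>\<close> and
  \<open>a = B + C\<close>, \<open>b = A + C\<close>, \<open>c = A + B\<close>. Below, \<open>p, q, n\<close> stand for \<open>A, B, C\<close> as natural numbers.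

  \<^emph>\<open>The determinant.\<close> As \<open>M = 0\<close>, the matrix is the Toeplitz matrix \<open>T (A + B)\<close> of size \<open>C\<close>, where
  \<open>T m\<close> has the entries \<open>binom m (A + j - i)\<close>. Let \<open>U\<close> be the unitriangular Pascal matrix with
  entries \<open>j choose i\<close>. By the convolution identity for binomial coefficients, the entries of
  \<open>T m * U\<close> are \<open>binom (m + j) (A + j - i)\<close>. For \<open>m = A + B\<close> and for \<open>m = A\<close> these agree up to
  factorials depending only on the row or only on the column, and \<open>T A\<close> is lower
  unitriangular; so the determinant is a quotient of products of factorials
  (\<open>det_toeplitz_binom_mat\<close>), and this quotient is \<open>Mac A B C\<close>. All factorials are those of
  numbers below \<open>\<sigma>\<close>, so the determinant does not vanish in a field of characteristic zero or at
  least \<open>\<sigma>\<close>.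

  \<^emph>\<open>The Lefschetz property.\<close> The linear form \<open>x + y + z\<close> works. Since \<open>x\<^sup>\<alpha> y\<^sup>\<beta> z\<^sup>\<gamma>\<close> has degree
  \<open>s + 2\<close>, the algebra coincides in degrees \<open>s\<close> and \<open>s + 1\<close> with the complete intersection
  \<open>P = K[x,y,z]/(x\<^sup>a, y\<^sup>b, z\<^sup>c)\<close>, whose socle degree \<open>a + b + c - 3\<close> is \<open>2 s + 1\<close>; these are the two middle
  degrees of \<open>P\<close>. Eliminating \<open>z = -(x + y)\<close> turns surjectivity of the middle map of \<open>P\<close> into a
  linear system with the above matrix (\<open>ci_middle_surjective\<close>), and the perfect pairing between
  the two middle degrees turns surjectivity into injectivity (\<open>ci_middle_injective\<close>).
  Surjectivity passes to higher degrees because the algebra is generated in degree 1.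
  Injectivity passes to lower degrees because every nonzero monomial of degree at most \<open>s\<close> has a
  nonzero multiple in degree \<open>s\<close> (\<open>aci_no_low_socle\<close>).\<close>

section \<open>The binomial determinant\<close>

lemma binom_of_nat [simp]: "binom (int n) (int k) = int (n choose k)"
  by (simp add: binom_def)

lemma binom_Suc: "binom (int (Suc p)) k = binom (int p) k + binom (int p) (k - 1)"
proof (cases "k \<le> 0")
  case True
  then show ?thesis by (cases "k = 0") (auto simp: binom_def)
next
  case False
  then obtain m where "k = int (Suc m)"
    by (metis gr0_implies_Suc not_le zero_less_imp_eq_int)
  then have k: "k = int (Suc m)" "k - 1 = int m" by auto
  show ?thesis unfolding k(2) unfolding k(1) binom_of_nat by simp
qed

text \<open>Pascal's rule in the upper argument, iterated \<open>j\<close> times. Read column by column, it says that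
  multiplying a Toeplitz matrix of binomials by the Pascal matrix raises the upper argument in
  column \<open>j\<close> by \<open>j\<close>.\<close>
lemma binom_convolution:
  "(\<Sum>m\<le>j. binom (int p) (t + int m) * int (j choose m)) = binom (int (p + j)) (t + int j)"
proof (induction j arbitrary: t)
  case 0
  then show ?case by simp
next
  case (Suc j)
  define g where "g = (\<lambda>m. binom (int p) (t + int m))"
  have "(\<Sum>m\<le>j. g m * int (j choose m)) = (\<Sum>m\<le>Suc j. g m * int (j choose m))"
    by simp
  also have "\<dots> = g 0 + (\<Sum>m\<le>j. g (Suc m) * int (j choose Suc m))"
    by (subst sum.atMost_Suc_shift) simp
  finally have *: "(\<Sum>m\<le>j. g m * int (j choose m)) = g 0 + (\<Sum>m\<le>j. g (Suc m) * int (j choose Suc m))" .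
  have "(\<Sum>m\<le>Suc j. g m * int (Suc j choose m))
      = g 0 + (\<Sum>m\<le>j. g (Suc m) * int (Suc j choose Suc m))"
    by (subst sum.atMost_Suc_shift) simp
  also have "\<dots> = (\<Sum>m\<le>j. g m * int (j choose m)) + (\<Sum>m\<le>j. g (Suc m) * int (j choose m))"
    unfolding * by (simp add: sum.distrib algebra_simps)
  also have "(\<Sum>m\<le>j. g m * int (j choose m)) = binom (int (p + j)) (t + int j)"
    unfolding g_def by (rule Suc.IH)
  also have "(\<Sum>m\<le>j. g (Suc m) * int (j choose m)) = binom (int (p + j)) (t + 1 + int j)"
    using Suc.IH[of "t + 1"] by (simp add: g_def algebra_simps)
  also have "binom (int (p + j)) (t + int j) + binom (int (p + j)) (t + 1 + int j)
      = binom (int (p + Suc j)) (t + int (Suc j))"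
    using binom_Suc[of "p + j" "t + 1 + int j"] by (simp add: algebra_simps)
  finally show ?case by (simp add: g_def)
qed

definition toeplitz_binom_mat :: "nat \<Rightarrow> nat \<Rightarrow> nat \<Rightarrow> int mat" where
  "toeplitz_binom_mat n p a = mat n n (\<lambda>(i, j). binom (int p) (int a + int j - int i))"

definition pascal_mat :: "nat \<Rightarrow> int mat" where
  "pascal_mat n = mat n n (\<lambda>(m, j). int (j choose m))"

lemma mat_carriers [simp]:
  "toeplitz_binom_mat n p a \<in> carrier_mat n n" "pascal_mat n \<in> carrier_mat n n"
  by (auto simp: toeplitz_binom_mat_def pascal_mat_def)

lemma det_pascal_mat: "det (pascal_mat n) = 1"
proof -
  have "det (pascal_mat n) = prod_list (diag_mat (pascal_mat n))"
    by (rule det_upper_triangular[of _ n]) (auto simp: pascal_mat_def upper_triangular_def)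
  also have "diag_mat (pascal_mat n) = replicate n 1"
    by (intro nth_equalityI) (auto simp: pascal_mat_def diag_mat_def)
  finally show ?thesis by simp
qed

text \<open>For \<open>p = a\<close> the entries right of the diagonal are \<open>binom a k\<close> with \<open>k > a\<close>, so the matrix is
  lower unitriangular. This is the reference case to which the general determinant is reduced.\<close>
lemma det_toeplitz_binom_mat_diagonal: "det (toeplitz_binom_mat n a a) = 1"
proof -
  have "det (toeplitz_binom_mat n a a) = prod_list (diag_mat (toeplitz_binom_mat n a a))"
    by (rule det_lower_triangular[of n]) (auto simp: toeplitz_binom_mat_def binom_def)
  also have "diag_mat (toeplitz_binom_mat n a a) = replicate n 1"
    by (intro nth_equalityI) (auto simp: toeplitz_binom_mat_def diag_mat_def binom_def)
  finally show ?thesis by simp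
qed

lemma det_mat_diag: "det (mat_diag n f) = (\<Prod>i<n. f i :: int)"
proof -
  have "det (mat_diag n f) = prod_list (diag_mat (mat_diag n f))"
    by (rule det_upper_triangular[of _ n]) (auto simp: mat_diag_def upper_triangular_def)
  also have "diag_mat (mat_diag n f) = map f [0..<n]"
    by (intro nth_equalityI) (auto simp: mat_diag_def diag_mat_def)
  finally show ?thesis by (simp add: prod.list_conv_set_nth atLeast0LessThan)
qed

lemma toeplitz_times_pascal:
  "toeplitz_binom_mat n p a * pascal_mat n
     = mat n n (\<lambda>(i, j). binom (int (p + j)) (int a + int j - int i))"
proof (rule eq_matI)
  fix i j assume "i < dim_row (mat n n (\<lambda>(i, j). binom (int (p + j)) (int a + int j - int i)))"
    "j < dim_col (mat n n (\<lambda>(i, j). binom (int (p + j)) (int a + int j - int i)))"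
  then have ij: "i < n" "j < n" by auto
  have "(toeplitz_binom_mat n p a * pascal_mat n) $$ (i, j)
      = (\<Sum>m<n. binom (int p) (int a + int m - int i) * int (j choose m))"
    using ij by (auto simp: toeplitz_binom_mat_def pascal_mat_def scalar_prod_def
        atLeast0LessThan intro!: sum.cong)
  also have "\<dots> = (\<Sum>m\<le>j. binom (int p) (int a - int i + int m) * int (j choose m))"
    using ij by (intro sum.mono_neutral_cong_right) (auto simp: algebra_simps)
  also have "\<dots> = binom (int (p + j)) (int a + int j - int i)"
    by (subst binom_convolution) (simp add: algebra_simps)
  finally show "(toeplitz_binom_mat n p a * pascal_mat n) $$ (i, j)
      = mat n n (\<lambda>(i, j). binom (int (p + j)) (int a + int j - int i)) $$ (i, j)"
    using ij by simp
qed (auto simp: toeplitz_binom_mat_def pascal_mat_def)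

text \<open>The entries of \<open>T (a + b) * U\<close> and of \<open>T a * U\<close> (notation of the introduction) differ
  only by a factor depending on the row and a factor depending on the column. Both sides are
  \<open>(a + j)! (a + b + j)! / (a + j - i)!\<close> when \<open>i \<le> a + j\<close> and \<open>0\<close> otherwise.\<close>
lemma fact_times_binom:
  "fact (b + i) * binom (int (a + b + j)) (int a + int j - int i) * fact (a + j)
     = fact i * binom (int (a + j)) (int a + int j - int i) * fact (a + b + j)"
proof (cases "i \<le> a + j")
  case False
  then show ?thesis by (simp add: binom_def)
next
  case True
  define k where "k = a + j - i"
  have k: "int a + int j - int i = int k" "a + j = k + i" "a + b + j = k + (b + i)"
    using True by (auto simp: k_def)
  have 1: "fact k * fact (b + i) * ((k + (b + i)) choose k) = (fact (k + (b + i)) :: nat)"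
    using binomial_fact_lemma[of k "k + (b + i)"] by simp
  have 2: "fact k * fact i * ((k + i) choose k) = (fact (k + i) :: nat)"
    using binomial_fact_lemma[of k "k + i"] by simp
  have 3: "fact (b + i) * ((k + (b + i)) choose k) * fact (k + i)
      = (fact i * ((k + i) choose k) * fact (k + (b + i)) :: nat)"
    unfolding 1[symmetric] 2[symmetric] by (simp only: ac_simps)
  have "int (fact (b + i) * ((k + (b + i)) choose k) * fact (k + i))
      = int (fact i * ((k + i) choose k) * fact (k + (b + i)))"
    by (simp only: 3)
  then show ?thesis unfolding k binom_of_nat by simp
qed

text \<open>MacMahon's product in integral form. Clearing the row and column factors by diagonal matrices of
  factorials identifies \<open>T (a + b) * U\<close> with \<open>T a * U\<close>, and both \<open>U\<close> and \<open>T a\<close> have determinant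
  1. No division occurs, so the identity can be read in any characteristic.\<close>
theorem det_toeplitz_binom_mat:
  "det (toeplitz_binom_mat n (a + b) a) * (\<Prod>i<n. fact (a + i) * fact (b + i))
     = (\<Prod>i<n. fact i * fact (a + b + i))"
proof -
  let ?D = "\<lambda>k. mat_diag n (\<lambda>i. fact (k + i) :: int)"
  let ?T = "\<lambda>p. toeplitz_binom_mat n p a * pascal_mat n"
  have T: "?T p \<in> carrier_mat n n" for p
    by (rule mult_carrier_mat[OF mat_carriers])
  have D: "?D k \<in> carrier_mat n n" for k
    by simp
  have "?D b * ?T (a + b) * ?D a = ?D 0 * ?T a * ?D (a + b)"
    by (subst (1 2) mat_diag_mult_left[OF T], subst (1 2) mat_diag_mult_right[of _ n n])
      (auto simp: toeplitz_times_pascal fact_times_binom simp del: of_nat_add intro!: eq_matI)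
  then have eq: "det (?D b * ?T (a + b) * ?D a) = det (?D 0 * ?T a * ?D (a + b))"
    by (rule arg_cong)
  have dets: "det (?D k * ?T p * ?D l)
      = (\<Prod>i<n. fact (k + i)) * det (toeplitz_binom_mat n p a) * (\<Prod>i<n. fact (l + i))" for k l p
    by (simp add: det_mult[of _ n] mult_carrier_mat[OF D T] T D det_mult[OF mat_carriers]
        det_mat_diag det_pascal_mat)
  show ?thesis
    using eq[unfolded dets] by (simp add: det_toeplitz_binom_mat_diagonal prod.distrib ac_simps)
qed

lemma hyperfactorial_add: "hyperfactorial (m + n) = hyperfactorial m * (\<Prod>i<n. fact (m + i))"
  by (induction n) (simp_all add: hyperfactorial_def)

lemma hyperfactorial_pos: "0 < hyperfactorial n"
  by (simp add: hyperfactorial_def)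

text \<open>The products of consecutive factorials are quotients of hyperfactorials.\<close>
corollary det_toeplitz_binom_mat_eq_Mac:
  "of_int (det (toeplitz_binom_mat n (a + b) a)) = Mac a b n"
proof -
  let ?d = "of_int (det (toeplitz_binom_mat n (a + b) a)) :: rat"
  let ?P = "\<lambda>k. \<Prod>i<n. fact (k + i) :: rat"
  have hf: "rat_of_nat (hyperfactorial (m + n)) = of_nat (hyperfactorial m) * ?P m" for m
    by (simp add: hyperfactorial_add)
  have hf0: "rat_of_nat (hyperfactorial n) = ?P 0"
    by (simp add: hyperfactorial_def)
  have P0: "?P k \<noteq> 0" for k by simp
  have "?d * (?P a * ?P b) = ?P 0 * ?P (a + b)"
    using arg_cong[OF det_toeplitz_binom_mat[of n a b], of "of_int :: int \<Rightarrow> rat"]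
    by (simp add: prod.distrib)
  then have "?d = ?P 0 * ?P (a + b) / (?P a * ?P b)"
    using P0 by (simp add: field_simps)
  also have "\<dots> = Mac a b n"
    unfolding Mac_def of_nat_mult hf hf0 using hyperfactorial_pos
    by (simp add: field_simps)
  finally show ?thesis .
qed

lemma of_int_fact_neq_0:
  assumes "CHAR('k::field) = 0 \<or> n < CHAR('k)"
  shows "(of_int (fact n) :: 'k) \<noteq> 0"
  using assms
proof (induction n)
  case (Suc n)
  then have "of_nat (Suc n) \<noteq> (0 :: 'k)"
    by (auto simp only: of_nat_eq_0_iff_char_dvd dest: dvd_imp_le)
  moreover have "of_int (fact n) \<noteq> (0 :: 'k)"
    using Suc by auto
  ultimately show ?case
    unfolding fact_Suc of_int_mult by simp
qed simp

text \<open>The largest factorial on the right of the integral product formula is \<open>(a + b + n - 1)!\<close>, so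
  the right-hand side, and with it the determinant, is prime to a characteristic of at least
  \<open>a + b + n\<close>.\<close>
lemma det_toeplitz_binom_mat_neq_0:
  assumes "CHAR('k::field) = 0 \<or> a + b + n \<le> CHAR('k)"
  shows "(of_int (det (toeplitz_binom_mat n (a + b) a)) :: 'k) \<noteq> 0"
proof
  assume "(of_int (det (toeplitz_binom_mat n (a + b) a)) :: 'k) = 0"
  then have "(of_int (\<Prod>i<n. fact i * fact (a + b + i)) :: 'k) = 0"
    unfolding det_toeplitz_binom_mat[symmetric] by simp
  moreover have "of_int (fact i) \<noteq> (0 :: 'k)" "of_int (fact (a + b + i)) \<noteq> (0 :: 'k)" if "i < n" for i
    using assms that by (auto intro!: of_int_fact_neq_0)
  ultimately show False by simp
qed

section \<open>Monomial ideals and homogeneous polynomials\<close>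

text \<open>Monomial ideals and graded components are both spanned by the monomials they contain, so one
  notion with its linear closure properties serves for both.\<close>
definition monomial_span :: "(nat \<times> nat \<times> nat) set \<Rightarrow> 'k::field poly3 set" where
  "monomial_span S = {f. Poly_Mapping.keys f \<subseteq> S}"

abbreviation monom3 :: "nat \<Rightarrow> nat \<Rightarrow> nat \<Rightarrow> 'k::field poly3" where
  "monom3 i j k \<equiv> Poly_Mapping.single (i, j, k) 1"

abbreviation up_closed :: "(nat \<times> nat \<times> nat) set \<Rightarrow> bool" where
  "up_closed S \<equiv> (\<forall>u\<in>S. \<forall>v. v + u \<in> S)"

lemma var_power:
  "var_x ^ n = (monom3 n 0 0 :: 'k::field poly3)"
  "var_y ^ n = (monom3 0 n 0 :: 'k::field poly3)"
  "var_z ^ n = (monom3 0 0 n :: 'k::field poly3)"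
  by (induction n) (simp_all add: var_x_def var_y_def var_z_def mult_single flip: single_one zero_prod_def)

lemma poly3_eq_sum_single:
  "f = (\<Sum>u\<in>Poly_Mapping.keys f. Poly_Mapping.single u (Poly_Mapping.lookup f u))"
  by (rule poly_mapping_eqI)
    (auto simp: lookup_sum lookup_single when_def in_keys_iff)

lemma monomial_span_zero [simp]: "0 \<in> monomial_span S"
  by (simp add: monomial_span_def)

lemma monomial_span_add: "f \<in> monomial_span S \<Longrightarrow> g \<in> monomial_span S \<Longrightarrow> f + g \<in> monomial_span S"
  using Poly_Mapping.keys_add[of f g] by (auto simp: monomial_span_def)

lemma monomial_span_sum: "(\<And>i. i \<in> A \<Longrightarrow> f i \<in> monomial_span S) \<Longrightarrow> sum f A \<in> monomial_span S"
  by (induction A rule: infinite_finite_induct) (auto intro: monomial_span_add)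

lemma monomial_span_uminus: "f \<in> monomial_span S \<Longrightarrow> - f \<in> monomial_span S"
  by (auto simp: monomial_span_def in_keys_iff)

lemma monomial_span_diff: "f \<in> monomial_span S \<Longrightarrow> g \<in> monomial_span S \<Longrightarrow> f - g \<in> monomial_span S"
  using monomial_span_add[of f S "- g"] monomial_span_uminus[of g S] by simp

lemma monomial_span_mult:
  "up_closed S \<Longrightarrow> f \<in> monomial_span S \<Longrightarrow> g * f \<in> monomial_span S"
  using Poly_Mapping.keys_mult[of g f] by (fastforce simp: monomial_span_def)

lemma monomial_span_single: "u \<in> S \<Longrightarrow> Poly_Mapping.single u x \<in> monomial_span S"
  by (simp add: monomial_span_def)

lemma homogeneous_eq_monomial_span:
  "homogeneous_poly3 d = monomial_span {(i, j, k). int (i + j + k) = d}"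
  by (auto simp: homogeneous_poly3_def monomial_span_def)

lemmas homogeneous_poly3_sum =
  monomial_span_sum[of _ _ "{(i, j, k). int (i + j + k) = d}" for d, folded homogeneous_eq_monomial_span]

lemmas homogeneous_poly3_closed =
  monomial_span_zero[of "{(i, j, k). int (i + j + k) = d}" for d, folded homogeneous_eq_monomial_span]
  monomial_span_add[of _ "{(i, j, k). int (i + j + k) = d}" for d, folded homogeneous_eq_monomial_span]
  monomial_span_uminus[of _ "{(i, j, k). int (i + j + k) = d}" for d, folded homogeneous_eq_monomial_span]
  monomial_span_diff[of _ "{(i, j, k). int (i + j + k) = d}" for d, folded homogeneous_eq_monomial_span]

lemma homogeneous_poly3_single:
  "int (i + j + k) = d \<Longrightarrow> Poly_Mapping.single (i, j, k) x \<in> homogeneous_poly3 d"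
  by (simp add: homogeneous_poly3_def)

lemma homogeneous_poly3_mult:
  assumes "f \<in> homogeneous_poly3 d" "g \<in> homogeneous_poly3 e"
  shows "f * g \<in> homogeneous_poly3 (d + e)"
  using assms Poly_Mapping.keys_mult[of f g] by (fastforce simp: homogeneous_poly3_def)

lemma homogeneous_poly3_power:
  "f \<in> homogeneous_poly3 1 \<Longrightarrow> f ^ n \<in> homogeneous_poly3 (int n)"
proof (induction n)
  case 0
  then show ?case by (simp add: homogeneous_poly3_def zero_prod_def)
next
  case (Suc n)
  then show ?case using homogeneous_poly3_mult[of f 1 "f ^ n" "int n"] by (simp add: add.commute)
qed

text \<open>The exponents of the monomials in \<open>(x\<^sup>a, y\<^sup>b, z\<^sup>c)\<close> and in
  \<open>(x\<^sup>a, y\<^sup>b, z\<^sup>c, x\<^sup>\<alpha> y\<^sup>\<beta> z\<^sup>\<gamma>)\<close>.\<close>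
definition ci_exponents :: "nat \<Rightarrow> nat \<Rightarrow> nat \<Rightarrow> (nat \<times> nat \<times> nat) set" where
  "ci_exponents a b c = {(i, j, k). a \<le> i \<or> b \<le> j \<or> c \<le> k}"

definition aci_exponents ::
    "nat \<Rightarrow> nat \<Rightarrow> nat \<Rightarrow> nat \<Rightarrow> nat \<Rightarrow> nat \<Rightarrow> (nat \<times> nat \<times> nat) set" where
  "aci_exponents a b c \<alpha> \<beta> \<gamma> = ci_exponents a b c \<union> {(i, j, k). \<alpha> \<le> i \<and> \<beta> \<le> j \<and> \<gamma> \<le> k}"

lemma up_closed_exponents:
  "up_closed (ci_exponents a b c)" "up_closed (aci_exponents a b c \<alpha> \<beta> \<gamma>)"
  by (auto simp: ci_exponents_def aci_exponents_def)

lemma ideal_monomial_span: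
  assumes "up_closed S"
  shows "ideal (monomial_span S) (poly3_ring :: 'k::field poly3 ring)"
proof -
  interpret R: cring "poly3_ring :: 'k poly3 ring"
    by (rule cring_from_type_algebra) 
  have neg: "\<ominus>\<^bsub>poly3_ring\<^esub> f = - f" for f :: "'k poly3"
    by (rule R.minus_equality) (auto simp: ring_of_type_algebra_def)
  show ?thesis
  proof (rule idealI)
    show "subgroup (monomial_span S) (add_monoid (poly3_ring :: 'k poly3 ring))"
    proof (rule subgroup.intro)
      show "inv\<^bsub>add_monoid poly3_ring\<^esub> f \<in> monomial_span S" if "f \<in> monomial_span S" for f :: "'k poly3"
        unfolding neg[unfolded a_inv_def] by (rule monomial_span_uminus[OF that])
    qed (auto simp: ring_of_type_algebra_def monomial_span_add)
  qed (use assms in \<open>auto simp: ring_of_type_algebra_def monomial_span_mult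
        monomial_span_mult[simplified mult.commute] intro: R.ring_axioms[unfolded ring_of_type_algebra_def]\<close>)
qed

lemma monomial_span_mono: "S \<subseteq> T \<Longrightarrow> monomial_span S \<subseteq> monomial_span T"
  by (auto simp: monomial_span_def)

text \<open>A monomial with exponent in the set is a multiple of one of the four generators; conversely the
  polynomials supported on the set form an ideal containing them. Membership in the ideal can
  therefore be tested monomial by monomial.\<close>
lemma almost_ci_ideal_eq_monomial_span:
  "(almost_ci_ideal a b c \<alpha> \<beta> \<gamma> :: 'k::field poly3 set) = monomial_span (aci_exponents a b c \<alpha> \<beta> \<gamma>)"
proof -
  interpret R: cring "poly3_ring :: 'k poly3 ring"
    by (rule cring_from_type_algebra)
  define E where "E = {(a, 0, 0), (0, b, 0), (0, 0, c), (\<alpha>, \<beta>, \<gamma>)}"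
  define G :: "'k poly3 set" where "G = (\<lambda>u. Poly_Mapping.single u 1) ` E"
  have "almost_ci_ideal a b c \<alpha> \<beta> \<gamma> = Idl\<^bsub>poly3_ring\<^esub> G"
    by (simp add: almost_ci_ideal_def G_def E_def var_power mult_single)
  moreover have "Idl\<^bsub>poly3_ring\<^esub> G \<subseteq> monomial_span (aci_exponents a b c \<alpha> \<beta> \<gamma>)"
    by (rule R.genideal_minimal[OF ideal_monomial_span[OF up_closed_exponents(2)]])
      (auto simp: G_def E_def aci_exponents_def ci_exponents_def intro!: monomial_span_single)
  moreover have "f \<in> Idl\<^bsub>poly3_ring\<^esub> G" if f: "f \<in> monomial_span (aci_exponents a b c \<alpha> \<beta> \<gamma>)" for f :: "'k poly3"
  proof -
    interpret J: ideal "Idl\<^bsub>poly3_ring\<^esub> G" "poly3_ring :: 'k poly3 ring"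
      by (rule R.genideal_ideal) (simp add: ring_of_type_algebra_def)
    have G: "G \<subseteq> Idl\<^bsub>poly3_ring\<^esub> G"
      by (rule R.genideal_self) (simp add: ring_of_type_algebra_def)
    have single: "Poly_Mapping.single u x \<in> Idl\<^bsub>poly3_ring\<^esub> G" if u_in: "u \<in> aci_exponents a b c \<alpha> \<beta> \<gamma>" for u x
    proof -
      obtain i j k where u: "u = (i, j, k)" by (cases u)
      \<comment> \<open>Split off the exponent of a generator that divides the monomial.\<close>
      have "\<exists>w\<in>E. \<exists>v. u = v + w"
      proof -
        consider "a \<le> i" | "b \<le> j" | "c \<le> k" | "\<alpha> \<le> i" "\<beta> \<le> j" "\<gamma> \<le> k"
          using u_in by (auto simp: u aci_exponents_def ci_exponents_def)
        then show ?thesis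
        proof cases
          case 1
          then have "u = (i - a, j, k) + (a, 0, 0)" by (simp add: u)
          then show ?thesis unfolding E_def by blast
        next
          case 2
          then have "u = (i, j - b, k) + (0, b, 0)" by (simp add: u)
          then show ?thesis unfolding E_def by blast
        next
          case 3
          then have "u = (i, j, k - c) + (0, 0, c)" by (simp add: u)
          then show ?thesis unfolding E_def by blast
        next
          case 4
          then have "u = (i - \<alpha>, j - \<beta>, k - \<gamma>) + (\<alpha>, \<beta>, \<gamma>)" by (simp add: u)
          then show ?thesis unfolding E_def by blast
        qed
      qed
      then obtain v w where vw: "w \<in> E" "u = v + w" by auto
      then have "Poly_Mapping.single w 1 \<in> Idl\<^bsub>poly3_ring\<^esub> G"
        using G by (auto simp: G_def)
      from J.I_l_closed[OF this, of "Poly_Mapping.single v x"] show ?thesis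
        by (simp add: ring_of_type_algebra_def mult_single vw)
    qed
    have "(\<Sum>u\<in>A. Poly_Mapping.single u (Poly_Mapping.lookup f u)) \<in> Idl\<^bsub>poly3_ring\<^esub> G"
      if "finite A" "A \<subseteq> aci_exponents a b c \<alpha> \<beta> \<gamma>" for A
      using that
    proof (induction A)
      case empty
      then show ?case using J.zero_closed by (simp add: ring_of_type_algebra_def)
    next
      case (insert u A)
      then have "Poly_Mapping.single u (Poly_Mapping.lookup f u) \<in> Idl\<^bsub>poly3_ring\<^esub> G"
        by (intro single) auto
      with insert J.a_closed[of "Poly_Mapping.single u (Poly_Mapping.lookup f u)"] show ?case
        by (auto simp: ring_of_type_algebra_def)
    qed
    from this[of "Poly_Mapping.keys f"] f show ?thesis
      by (simp add: monomial_span_def flip: poly3_eq_sum_single)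
  qed
  ultimately show ?thesis by blast
qed

section \<open>Multiplication by a linear form on a quotient\<close>

lemma coset_eq_iff:
  fixes f g :: "'k::field poly3"
  assumes "ideal I poly3_ring"
  shows "I +>\<^bsub>poly3_ring\<^esub> f = I +>\<^bsub>poly3_ring\<^esub> g \<longleftrightarrow> f - g \<in> I"
proof -
  interpret ideal I "poly3_ring :: 'k poly3 ring" by (rule assms)
  have coset: "I +>\<^bsub>poly3_ring\<^esub> f = {h. h - f \<in> I}" for f
    by (auto simp: a_r_coset_def' ring_of_type_algebra_def algebra_simps)
  have zero: "0 \<in> I"
    using additive_subgroup.zero_closed[OF is_additive_subgroup] by (simp add: ring_of_type_algebra_def)
  have add: "x + y \<in> I" if "x \<in> I" "y \<in> I" for x y
    using additive_subgroup.a_closed[OF is_additive_subgroup that] by (simp add: ring_of_type_algebra_def)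
  have neg: "- x \<in> I" if "x \<in> I" for x
    using I_l_closed[OF that, of "- 1"] by (simp add: ring_of_type_algebra_def)
  have "h - g \<in> I \<longleftrightarrow> h - f \<in> I" if "f - g \<in> I" for h
    using add[of "h - f" "f - g"] add[of "h - g" "- (f - g)"] neg[OF that] that by auto
  then show ?thesis unfolding coset using zero by auto
qed

text \<open>Injectivity and surjectivity in the quotient ring, pulled back to polynomials modulo \<open>I\<close>.\<close>
lemma weak_lefschetz_quotientI:
  fixes l :: "'k::field poly3"
  assumes I: "ideal I poly3_ring" and l: "l \<in> homogeneous_poly3 1"
    and inj_or_surj: "\<And>d. (\<forall>f\<in>homogeneous_poly3 d. l * f \<in> I \<longrightarrow> f \<in> I) \<or>
            (\<forall>g\<in>homogeneous_poly3 (d + 1). \<exists>f\<in>homogeneous_poly3 d. g - l * f \<in> I)"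
  shows "weak_lefschetz (poly3_ring Quot I) (quot_component I)"
proof -
  let ?c = "\<lambda>f. I +>\<^bsub>poly3_ring\<^esub> f"
  interpret ideal I "poly3_ring :: 'k poly3 ring" by (rule I)
  have mult: "?c f \<otimes>\<^bsub>poly3_ring Quot I\<^esub> ?c g = ?c (f * g)" for f g
    using rcoset_mult_add[of f g] by (simp add: FactRing_def ring_of_type_algebra_def)
  have "inj_on (\<lambda>f. ?c l \<otimes>\<^bsub>poly3_ring Quot I\<^esub> f) (quot_component I d) \<or>
      (\<lambda>f. ?c l \<otimes>\<^bsub>poly3_ring Quot I\<^esub> f) ` quot_component I d = quot_component I (d + 1)" for d
    using inj_or_surj[of d]
  proof (elim disjE)
    assume inj: "\<forall>f\<in>homogeneous_poly3 d. l * f \<in> I \<longrightarrow> f \<in> I"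
    have "f - g \<in> I" if "f \<in> homogeneous_poly3 d" "g \<in> homogeneous_poly3 d" "l * f - l * g \<in> I" for f g
      using inj homogeneous_poly3_closed(4)[OF that(1,2)] that(3) by (simp add: algebra_simps)
    then show ?thesis
      by (auto simp: inj_on_def quot_component_def mult coset_eq_iff[OF I])
  next
    assume surj: "\<forall>g\<in>homogeneous_poly3 (d + 1). \<exists>f\<in>homogeneous_poly3 d. g - l * f \<in> I"
    have "l * f \<in> homogeneous_poly3 (d + 1)" if "f \<in> homogeneous_poly3 d" for f
      using homogeneous_poly3_mult[OF l that] by (simp add: add.commute)
    moreover have "\<exists>f\<in>homogeneous_poly3 d. ?c g = ?c (l * f)" if "g \<in> homogeneous_poly3 (d + 1)" for g
      using surj that by (auto simp: coset_eq_iff[OF I])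
    ultimately have "(\<lambda>f. ?c (l * f)) ` homogeneous_poly3 d = ?c ` homogeneous_poly3 (d + 1)"
      by (intro subset_antisym image_subsetI) (blast intro: imageI, metis (no_types, lifting) imageI)
    then show ?thesis
      by (simp add: quot_component_def mult image_image)
  qed
  with l show ?thesis
    unfolding weak_lefschetz_def by (auto simp: quot_component_def)
qed

section \<open>The image of the Lefschetz map\<close>

abbreviation lin3 :: "'k::field poly3" where
  "lin3 \<equiv> monom3 1 0 0 + monom3 0 1 0 + monom3 0 0 1"

text \<open>The polynomials whose class modulo the monomials in \<open>S\<close> is \<open>x + y + z\<close> times a class of
  degree \<open>d\<close>. Keeping track of the degree of \<open>h\<close> makes surjectivity of the multiplication map from
  degree \<open>d\<close> the inclusion \<open>homogeneous_poly3 (d + 1) \<subseteq> lefschetz_image S d\<close>.\<close>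
definition lefschetz_image :: "(nat \<times> nat \<times> nat) set \<Rightarrow> int \<Rightarrow> 'k::field poly3 set" where
  "lefschetz_image S d = {g. \<exists>h\<in>homogeneous_poly3 d. g - lin3 * h \<in> monomial_span S}"

lemma lin3_homogeneous: "lin3 \<in> homogeneous_poly3 1"
  by (intro homogeneous_poly3_closed homogeneous_poly3_single) auto

lemma lefschetz_image_mono: "S \<subseteq> T \<Longrightarrow> lefschetz_image S d \<subseteq> lefschetz_image T d"
  using monomial_span_mono[of S T] by (auto simp: lefschetz_image_def)

lemma lefschetz_image_lin3: "h \<in> homogeneous_poly3 d \<Longrightarrow> lin3 * h \<in> lefschetz_image S d"
  by (auto simp: lefschetz_image_def intro!: bexI[of _ h])

lemma lefschetz_image_span: "f \<in> monomial_span S \<Longrightarrow> f \<in> lefschetz_image S d"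
  by (auto simp: lefschetz_image_def homogeneous_poly3_closed intro!: bexI[of _ 0])

lemma lefschetz_image_add:
  assumes "f \<in> lefschetz_image S d" "g \<in> lefschetz_image S d"
  shows "f + g \<in> lefschetz_image S d"
proof -
  from assms obtain h1 h2 where h: "h1 \<in> homogeneous_poly3 d" "h2 \<in> homogeneous_poly3 d"
    "f - lin3 * h1 \<in> monomial_span S" "g - lin3 * h2 \<in> monomial_span S"
    by (auto simp: lefschetz_image_def)
  have "(f + g) - lin3 * (h1 + h2) = (f - lin3 * h1) + (g - lin3 * h2)"
    by (simp add: algebra_simps)
  with h show ?thesis
    unfolding lefschetz_image_def mem_Collect_eq
    by (intro bexI[of _ "h1 + h2"]) (auto simp only: intro: monomial_span_add homogeneous_poly3_closed)
qed

lemma lefschetz_image_mult: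
  assumes "up_closed S" "g \<in> lefschetz_image S d" "v \<in> homogeneous_poly3 e"
  shows "v * g \<in> lefschetz_image S (e + d)"
proof -
  from assms obtain h where h: "h \<in> homogeneous_poly3 d" "g - lin3 * h \<in> monomial_span S"
    by (auto simp: lefschetz_image_def)
  have "v * g - lin3 * (v * h) = v * (g - lin3 * h)"
    by (simp add: algebra_simps)
  with h assms show ?thesis
    unfolding lefschetz_image_def mem_Collect_eq
    by (intro bexI[of _ "v * h"]) (auto simp only: intro: monomial_span_mult homogeneous_poly3_mult)
qed

lemma lefschetz_image_smult:
  assumes "up_closed S" "g \<in> lefschetz_image S d"
  shows "Poly_Mapping.single 0 x * g \<in> lefschetz_image S d"
  using lefschetz_image_mult[OF assms homogeneous_poly3_single[of 0 0 0 0 x]]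
  by (simp add: zero_prod_def)

lemma lefschetz_image_uminus:
  assumes "up_closed S" "g \<in> lefschetz_image S d"
  shows "- g \<in> lefschetz_image S d"
  using lefschetz_image_smult[OF assms, of "- 1"] by (simp add: single_uminus)

lemma lefschetz_image_diff:
  assumes "up_closed S" "f \<in> lefschetz_image S d" "g \<in> lefschetz_image S d"
  shows "f - g \<in> lefschetz_image S d"
  using lefschetz_image_add[OF assms(2) lefschetz_image_uminus[OF assms(1,3)]] by simp

lemma lefschetz_image_sum:
  "(\<And>i. i \<in> A \<Longrightarrow> f i \<in> lefschetz_image S d) \<Longrightarrow> sum f A \<in> lefschetz_image S d"
  by (induction A rule: infinite_finite_induct)
    (auto intro: lefschetz_image_add lefschetz_image_span)

lemma homogeneous_subset_lefschetz_imageI: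
  assumes S: "up_closed S"
    and "\<And>i j k. int (i + j + k) = e \<Longrightarrow> monom3 i j k \<in> (lefschetz_image S d :: 'k::field poly3 set)"
  shows "homogeneous_poly3 e \<subseteq> (lefschetz_image S d :: 'k poly3 set)"
proof
  fix g :: "'k poly3" assume g: "g \<in> homogeneous_poly3 e"
  have "(\<Sum>u\<in>Poly_Mapping.keys g. Poly_Mapping.single u (Poly_Mapping.lookup g u)) \<in> lefschetz_image S d"
  proof (rule lefschetz_image_sum)
    fix u assume u: "u \<in> Poly_Mapping.keys g"
    obtain i j k where ijk: "u = (i, j, k)" by (cases u)
    have "int (i + j + k) = e"
      using g u by (auto simp: homogeneous_poly3_def ijk)
    then have "Poly_Mapping.single u 1 \<in> (lefschetz_image S d :: 'k poly3 set)"
      unfolding ijk by (rule assms(2))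
    from lefschetz_image_smult[OF S this, of "Poly_Mapping.lookup g u"]
    show "Poly_Mapping.single u (Poly_Mapping.lookup g u) \<in> lefschetz_image S d"
      by (simp add: mult_single)
  qed
  then show "g \<in> lefschetz_image S d"
    by (simp flip: poly3_eq_sum_single)
qed

text \<open>Every monomial of degree \<open>d + 1\<close> is a variable times a monomial of degree \<open>d\<close>, and the image is
  stable under multiplication; hence surjectivity passes to all higher degrees.\<close>
lemma lefschetz_surjective_Suc:
  assumes S: "up_closed S" and d: "0 \<le> d"
    and "homogeneous_poly3 d \<subseteq> (lefschetz_image S (d - 1) :: 'k::field poly3 set)"
  shows "homogeneous_poly3 (d + 1) \<subseteq> (lefschetz_image S d :: 'k poly3 set)"
proof (rule homogeneous_subset_lefschetz_imageI[OF S])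
  fix i j k :: nat assume deg: "int (i + j + k) = d + 1"
  have step: "monom3 i' j' k' * (monom3 i'' j'' k'' :: 'k poly3) \<in> lefschetz_image S d"
    if "int (i' + j' + k') = 1" "int (i'' + j'' + k'') = d" for i' j' k' i'' j'' k''
  proof -
    have "monom3 i'' j'' k'' \<in> (lefschetz_image S (d - 1) :: 'k poly3 set)"
      using assms(3) homogeneous_poly3_single[OF that(2)] by blast
    from lefschetz_image_mult[OF S this homogeneous_poly3_single[OF that(1), of 1]]
    show ?thesis by simp
  qed
  consider "i > 0" | "j > 0" | "k > 0" using deg d by linarith
  then show "monom3 i j k \<in> (lefschetz_image S d :: 'k poly3 set)"
  proof cases
    case 1
    then show ?thesis using step[of 1 0 0 "i - 1" j k] deg by (simp add: mult_single)
  next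
    case 2
    then show ?thesis using step[of 0 1 0 i "j - 1" k] deg by (simp add: mult_single)
  next
    case 3
    then show ?thesis using step[of 0 0 1 i j "k - 1"] deg by (simp add: mult_single)
  qed
qed

lemma lefschetz_surjective_above:
  assumes S: "up_closed S" and d: "0 \<le> d" "d \<le> e"
    and base: "homogeneous_poly3 d \<subseteq> (lefschetz_image S (d - 1) :: 'k::field poly3 set)"
  shows "homogeneous_poly3 e \<subseteq> (lefschetz_image S (e - 1) :: 'k poly3 set)"
  using d(2)
proof (induction e rule: int_ge_induct)
  case base
  then show ?case by (rule assms(4))
next
  case (step e)
  then show ?case using lefschetz_surjective_Suc[OF S _ step.IH] d(1) by simp
qed

text \<open>Modulo \<open>x + y + z\<close> the variable \<open>z\<close> is \<open>-(x + y)\<close>, and \<open>z - w\<close> divides \<open>z\<^sup>k - w\<^sup>k\<close>.\<close>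
lemma eliminate_z_power:
  assumes "int (i + j + k) = d + 1"
  shows "monom3 i j k - monom3 i j 0 * (- (monom3 0 1 0 + monom3 1 0 0)) ^ k
           \<in> (lefschetz_image S d :: 'k::field poly3 set)"
proof (cases k)
  case 0
  then show ?thesis by (simp add: lefschetz_image_span flip: zero_prod_def)
next
  case (Suc k')
  let ?w = "- (monom3 0 1 0 + monom3 1 0 0) :: 'k poly3"
  let ?z = "monom3 0 0 1 :: 'k poly3"
  define h where "h = monom3 i j 0 * (\<Sum>m<k. ?w ^ (k - Suc m) * ?z ^ m)"
  have zk: "?z ^ k = monom3 0 0 k"
    using var_power(3)[of k] by (simp add: var_z_def)
  have "?w \<in> homogeneous_poly3 1" "?z \<in> homogeneous_poly3 1"
    by (auto intro!: homogeneous_poly3_closed homogeneous_poly3_single)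
  then have "?w ^ (k - Suc m) * ?z ^ m \<in> homogeneous_poly3 (int k - 1)" if "m < k" for m
    using homogeneous_poly3_mult[OF homogeneous_poly3_power homogeneous_poly3_power, of ?w ?z "k - Suc m" m] that
    by (simp add: of_nat_diff)
  then have "h \<in> homogeneous_poly3 (int (i + j) + (int k - 1))"
    unfolding h_def by (intro homogeneous_poly3_mult homogeneous_poly3_single homogeneous_poly3_sum) auto
  moreover have "monom3 i j k - monom3 i j 0 * ?w ^ k = lin3 * h"
  proof -
    have "monom3 i j k = monom3 i j 0 * ?z ^ k"
      unfolding zk by (simp add: mult_single)
    then have "monom3 i j k - monom3 i j 0 * ?w ^ k = monom3 i j 0 * (?z ^ k - ?w ^ k)"
      by (simp only: right_diff_distrib)
    also have "?z ^ k - ?w ^ k = lin3 * (\<Sum>m<k. ?w ^ (k - Suc m) * ?z ^ m)"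
      by (subst power_diff_sumr2) (simp add: algebra_simps)
    finally show ?thesis by (simp add: h_def ac_simps)
  qed
  moreover have "int (i + j) + (int k - 1) = d"
    using assms by simp
  ultimately show ?thesis
    by (simp only: lefschetz_image_lin3)
qed

lemma binomial_expansion_xy:
  "monom3 i j 0 * (monom3 0 1 0 + monom3 1 0 0) ^ c
     = (\<Sum>e\<le>i + j + c. Poly_Mapping.single (i + j + c - e, e, 0)
          (of_int (binom (int c) (int e - int j))) :: 'k::field poly3)"
proof -
  let ?t = "\<lambda>m. Poly_Mapping.single (i + (c - m), j + m, 0) (of_nat (c choose m)) :: 'k poly3"
  have xy: "(monom3 0 1 0 :: 'k poly3) ^ m = monom3 0 m 0" "(monom3 1 0 0 :: 'k poly3) ^ m = monom3 m 0 0" for m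
    using var_power(1,2)[of m] by (simp_all add: var_x_def var_y_def)
  have expand: "monom3 i j 0 * (of_nat (c choose m) * monom3 0 1 0 ^ m * monom3 1 0 0 ^ (c - m)) = ?t m" for m
    unfolding xy single_of_nat[symmetric] zero_prod_def mult_single by simp
  have "(monom3 i j 0 * (monom3 0 1 0 + monom3 1 0 0) ^ c :: 'k poly3) = (\<Sum>m\<le>c. ?t m)"
    unfolding binomial_ring sum_distrib_left expand ..
  also have "\<dots> = (\<Sum>e\<in>{j..j + c}. Poly_Mapping.single (i + j + c - e, e, 0)
          (of_int (binom (int c) (int e - int j))))"
    by (rule sum.reindex_bij_witness[of _ "\<lambda>e. e - j" "\<lambda>m. j + m"])
      (auto simp: algebra_simps)
  also have "\<dots> = (\<Sum>e\<le>i + j + c. Poly_Mapping.single (i + j + c - e, e, 0)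
          (of_int (binom (int c) (int e - int j))))"
    by (rule sum.mono_neutral_left) (auto simp: binom_def binomial_eq_0)
  finally show ?thesis .
qed

section \<open>The middle degrees of the complete intersection\<close>

lemma single_sum: "Poly_Mapping.single u (sum f A) = (\<Sum>i\<in>A. Poly_Mapping.single u (f i))"
  by (induction A rule: infinite_finite_induct) (simp_all add: single_add)

text \<open>With \<open>a = q + n\<close>, \<open>b = p + n\<close>, \<open>c = p + q\<close>, put \<open>r = p + q + n - 1\<close>. Among the monomials
  \<open>x\<^sup>r\<^sup>-\<^sup>e y\<^sup>e\<close>, those with \<open>e < p\<close> are multiples of \<open>x\<^sup>a\<close> and those with
  \<open>e \<ge> p + n\<close> are multiples of \<open>y\<^sup>b\<close>, so exactly \<open>n\<close> middle ones remain. The \<open>n\<close> multiples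
  \<open>x\<^sup>n\<^sup>-\<^sup>1\<^sup>-\<^sup>k y\<^sup>k z\<^sup>c\<close> of \<open>z\<^sup>c\<close> become
  \<open>\<plusminus> x\<^sup>n\<^sup>-\<^sup>1\<^sup>-\<^sup>k y\<^sup>k (x + y)\<^sup>c\<close>, and their coordinates with respect to the middle
  monomials are the rows of the binomial matrix. The adjugate matrix solves this system up to
  the factor \<open>det\<close>, which is a unit in the field.\<close>
lemma ci_middle_surjective:
  fixes p q n :: nat
  assumes det: "(of_int (det (toeplitz_binom_mat n (p + q) p)) :: 'k::field) \<noteq> 0"
    and pos: "0 < p + q + n"
  shows "homogeneous_poly3 (int (p + q + n) - 1)
    \<subseteq> (lefschetz_image (ci_exponents (q + n) (p + n) (p + q)) (int (p + q + n) - 2) :: 'k poly3 set)"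
proof (rule homogeneous_subset_lefschetz_imageI[OF up_closed_exponents(1)])
  define r where "r = p + q + n - 1"
  let ?S = "ci_exponents (q + n) (p + n) (p + q)"
  let ?W = "lefschetz_image ?S (int (p + q + n) - 2) :: 'k poly3 set"
  let ?N = "toeplitz_binom_mat n (p + q) p"
  let ?mid = "\<lambda>j x. Poly_Mapping.single (r - (p + j), p + j, 0) x :: 'k poly3"
  have S: "up_closed ?S" by (rule up_closed_exponents)
  have outer: "Poly_Mapping.single (r - e, e, 0) x \<in> ?W" if "e < p \<or> p + n \<le> e" for e x
    using that by (intro lefschetz_image_span monomial_span_single) (auto simp: ci_exponents_def r_def)
  \<comment> \<open>Row \<open>k\<close> of the matrix: the binomial expansion, stripped of its outer monomials.\<close>
  have row: "(\<Sum>j<n. ?mid j (of_int (?N $$ (k, j)))) \<in> ?W" if k: "k < n" for k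
  proof -
    let ?xy = "monom3 0 1 0 + monom3 1 0 0 :: 'k poly3"
    let ?v = "monom3 (n - 1 - k) k 0 * ?xy ^ (p + q)"
    let ?f = "\<lambda>e. Poly_Mapping.single (r - e, e, 0) (of_int (binom (int (p + q)) (int e - int k))) :: 'k poly3"
    have deg: "n - 1 - k + k + (p + q) = r" using k by (simp add: r_def)
    have "monom3 (n - 1 - k) k (p + q) - monom3 (n - 1 - k) k 0 * (- ?xy) ^ (p + q) \<in> ?W"
      using deg k by (intro eliminate_z_power) (simp add: r_def)
    moreover have "monom3 (n - 1 - k) k (p + q) \<in> ?W"
      by (intro lefschetz_image_span monomial_span_single) (simp add: ci_exponents_def)
    ultimately have "monom3 (n - 1 - k) k 0 * (- ?xy) ^ (p + q) \<in> ?W"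
      using lefschetz_image_diff[OF S] by fastforce
    then have "?v \<in> ?W"
    proof (cases "even (p + q)")
      case True
      show ?thesis
        using \<open>monom3 (n - 1 - k) k 0 * (- ?xy) ^ (p + q) \<in> ?W\<close> unfolding power_minus_even[OF True] .
    next
      case False
      have "- ?v \<in> ?W"
        using \<open>monom3 (n - 1 - k) k 0 * (- ?xy) ^ (p + q) \<in> ?W\<close>
        unfolding power_minus_odd[OF False] mult_minus_right .
      from lefschetz_image_uminus[OF S this] show ?thesis
        unfolding minus_minus .
    qed
    moreover have "?v = (\<Sum>e\<le>r. ?f e)"
      by (subst binomial_expansion_xy) (simp only: deg)
    moreover have "(\<Sum>e\<le>r. ?f e) = (\<Sum>e\<in>{..r} - {p..<p + n}. ?f e) + (\<Sum>e\<in>{p..<p + n}. ?f e)"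
      by (rule sum.subset_diff) (auto simp: r_def)
    moreover have "(\<Sum>e\<in>{..r} - {p..<p + n}. ?f e) \<in> ?W"
      by (intro lefschetz_image_sum outer) auto
    moreover have "(\<Sum>e\<in>{p..<p + n}. ?f e) = (\<Sum>j<n. ?mid j (of_int (?N $$ (k, j))))"
      by (rule sum.reindex_bij_witness[of _ "\<lambda>j. p + j" "\<lambda>e. e - p"])
        (use k in \<open>auto simp: toeplitz_binom_mat_def\<close>)
    ultimately show ?thesis
      using lefschetz_image_diff[OF S] by fastforce
  qed
  \<comment> \<open>Row \<open>j\<close> of the adjugate combines the rows into the determinant times one monomial.\<close>
  have mid: "?mid j 1 \<in> ?W" if j: "j < n" for j
  proof -
    let ?d = "of_int (det ?N) :: 'k"
    have N: "?N \<in> carrier_mat n n" by simp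
    have adj: "(\<Sum>k<n. adj_mat ?N $$ (j, k) * ?N $$ (k, m)) = (if m = j then det ?N else 0)"
      if "m < n" for m
    proof -
      have "(adj_mat ?N * ?N) $$ (j, m) = (\<Sum>k<n. adj_mat ?N $$ (j, k) * ?N $$ (k, m))"
        using that j adj_mat(1)[OF N] N
        by (simp add: scalar_prod_def atLeast0LessThan carrier_matD[OF N] carrier_matD[OF adj_mat(1)[OF N]])
      then show ?thesis
        unfolding adj_mat(3)[OF N] using that j by auto
    qed
    have "(\<Sum>k<n. Poly_Mapping.single 0 (of_int (adj_mat ?N $$ (j, k)))
             * (\<Sum>m<n. ?mid m (of_int (?N $$ (k, m))))) \<in> ?W"
      by (intro lefschetz_image_sum lefschetz_image_smult[OF S] row) auto
    also have "(\<Sum>k<n. Poly_Mapping.single 0 (of_int (adj_mat ?N $$ (j, k)))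
             * (\<Sum>m<n. ?mid m (of_int (?N $$ (k, m)))))
        = (\<Sum>k<n. \<Sum>m<n. ?mid m (of_int (adj_mat ?N $$ (j, k) * ?N $$ (k, m))))"
      by (simp add: sum_distrib_left mult_single del: single_of_int)
    also have "\<dots> = (\<Sum>m<n. \<Sum>k<n. ?mid m (of_int (adj_mat ?N $$ (j, k) * ?N $$ (k, m))))"
      by (rule sum.swap)
    also have "\<dots> = (\<Sum>m<n. ?mid m (of_int (\<Sum>k<n. adj_mat ?N $$ (j, k) * ?N $$ (k, m))))"
      unfolding of_int_sum by (intro sum.cong refl) (simp add: single_sum)
    also have "\<dots> = (\<Sum>m<n. if m = j then ?mid j ?d else 0)"
      by (intro sum.cong refl) (simp add: adj)
    also have "\<dots> = ?mid j ?d"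
      using j by simp
    finally have "Poly_Mapping.single 0 (inverse ?d) * ?mid j ?d \<in> ?W"
      by (rule lefschetz_image_smult[OF S])
    with det show ?thesis by (simp add: mult_single)
  qed
  \<comment> \<open>All monomials of degree \<open>r\<close> without \<open>z\<close> are covered; the others reduce to them.\<close>
  have xy: "monom3 i j 0 \<in> ?W" if "i + j = r" for i j
  proof (cases "p \<le> j \<and> j < p + n")
    case True
    with mid[of "j - p"] that show ?thesis by auto
  next
    case False
    with outer[of j 1] that show ?thesis by auto
  qed
  show "monom3 i j k \<in> ?W" if "int (i + j + k) = int (p + q + n) - 1" for i j k
    using that
  proof (induction k arbitrary: i j)
    case 0
    with xy show ?case by (simp add: r_def)
  next
    case (Suc k)
    have "monom3 i j (Suc k) = lin3 * monom3 i j k - monom3 (Suc i) j k - (monom3 i (Suc j) k :: 'k poly3)"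
      by (simp add: distrib_right mult_single)
    moreover have "lin3 * monom3 i j k \<in> ?W"
      using Suc.prems by (intro lefschetz_image_lin3 homogeneous_poly3_single) simp
    moreover have "monom3 (Suc i) j k \<in> ?W"
      by (rule Suc.IH) (use Suc.prems in simp)
    moreover have "monom3 i (Suc j) k \<in> ?W"
      by (rule Suc.IH) (use Suc.prems in simp)
    ultimately show ?case
      by (simp only: lefschetz_image_diff[OF S])
  qed
qed

text \<open>Multiplication by a monomial shifts the coefficients.\<close>
lemma lookup_times_single:
  "Poly_Mapping.lookup (f * Poly_Mapping.single v 1) (u + v) = Poly_Mapping.lookup (f :: 'k::field poly3) u"
proof -
  have "f * Poly_Mapping.single v 1
      = (\<Sum>w\<in>Poly_Mapping.keys f. Poly_Mapping.single (w + v) (Poly_Mapping.lookup f w))"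
    by (subst poly3_eq_sum_single[of f]) (simp add: sum_distrib_right mult_single)
  then show ?thesis
    by (auto simp: lookup_sum lookup_single when_def in_keys_iff)
qed

text \<open>Duality: modulo \<open>(x\<^sup>a, y\<^sup>b, z\<^sup>c)\<close> the monomial \<open>x\<^sup>a\<^sup>-\<^sup>1 y\<^sup>b\<^sup>-\<^sup>1 z\<^sup>c\<^sup>-\<^sup>1\<close> is
  nonzero and pairs the degrees \<open>s\<close> and \<open>s + 1\<close> perfectly. If \<open>x + y + z\<close> kills \<open>f\<close>, then \<open>f\<close>
  kills the image of \<open>x + y + z\<close>, which is all of degree \<open>s + 1\<close>; so every coefficient of \<open>f\<close>,
  being the top coefficient of \<open>f\<close> times the complementary monomial, vanishes.\<close>
lemma ci_middle_injective:
  fixes f :: "'k::field poly3"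
  assumes f: "f \<in> homogeneous_poly3 s" "lin3 * f \<in> monomial_span (ci_exponents a b c)"
    and sum: "int (a + b + c) = 2 * s + 4"
    and surj: "homogeneous_poly3 (s + 1) \<subseteq> (lefschetz_image (ci_exponents a b c) s :: 'k poly3 set)"
  shows "f \<in> monomial_span (ci_exponents a b c)"
proof (rule ccontr)
  let ?S = "ci_exponents a b c"
  assume "f \<notin> monomial_span ?S"
  then obtain i j k where u: "(i, j, k) \<in> Poly_Mapping.keys f" "(i, j, k) \<notin> ?S"
    by (auto simp: monomial_span_def)
  then have less: "i < a" "j < b" "k < c" by (auto simp: ci_exponents_def)
  have deg: "int (i + j + k) = s" using u f by (auto simp: homogeneous_poly3_def)
  \<comment> \<open>The complementary monomial isolates the coefficient of \<open>f\<close> at \<open>(i, j, k)\<close>.\<close>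
  define v where "v = (a - 1 - i, b - 1 - j, c - 1 - k)"
  let ?g = "Poly_Mapping.single v 1 :: 'k poly3"
  have "?g \<in> homogeneous_poly3 (s + 1)"
    unfolding v_def using less deg sum by (intro homogeneous_poly3_single) (auto simp: of_nat_diff)
  with surj obtain h where h: "?g - lin3 * h \<in> monomial_span ?S"
    by (auto simp: lefschetz_image_def)
  have "f * ?g = h * (lin3 * f) + f * (?g - lin3 * h)" by (simp add: algebra_simps)
  then have "f * ?g \<in> monomial_span ?S"
    using f(2) h by (auto simp only: intro!: monomial_span_add monomial_span_mult up_closed_exponents)
  moreover have "(i, j, k) + v \<in> Poly_Mapping.keys (f * ?g)"
    using u(1) by (simp only: in_keys_iff lookup_times_single not_False_eq_True)
  ultimately have "(i, j, k) + v \<in> ?S"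
    unfolding monomial_span_def by blast
  then show False
    using less by (auto simp: v_def ci_exponents_def)
qed

section \<open>The almost complete intersection\<close>

text \<open>A nonzero monomial of a kernel element of degree \<open>d\<close> stays nonzero after multiplication by a
  suitable monomial of degree \<open>s - d\<close>; the product is then a nonzero kernel element of degree
  \<open>s\<close>. The assumption \<open>no_socle\<close> says that no nonzero monomial of degree below \<open>s\<close> is annihilated
  by all variables.\<close>
lemma lefschetz_injective_below:
  fixes f :: "'k::field poly3"
  assumes S: "up_closed S"
    and inj: "\<And>f. (f :: 'k poly3) \<in> homogeneous_poly3 s \<Longrightarrow> lin3 * f \<in> monomial_span S \<Longrightarrow> f \<in> monomial_span S"
    and no_socle: "\<And>i j k. (i, j, k) \<notin> S \<Longrightarrow> int (i + j + k) \<le> s \<Longrightarrow>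
        \<exists>i' j' k'. i \<le> i' \<and> j \<le> j' \<and> k \<le> k' \<and> int (i' + j' + k') = s \<and> (i', j', k') \<notin> S"
    and d: "d \<le> s" and f: "f \<in> homogeneous_poly3 d" "lin3 * f \<in> monomial_span S"
  shows "f \<in> monomial_span S"
proof (rule ccontr)
  assume "f \<notin> monomial_span S"
  then obtain i j k where u: "(i, j, k) \<in> Poly_Mapping.keys f" "(i, j, k) \<notin> S"
    by (auto simp: monomial_span_def)
  have deg: "int (i + j + k) = d" using u f by (auto simp: homogeneous_poly3_def)
  with no_socle[OF u(2)] d obtain i' j' k' where
    u': "i \<le> i'" "j \<le> j'" "k \<le> k'" "int (i' + j' + k') = s" "(i', j', k') \<notin> S"
    by blast
  define v where "v = (i' - i, j' - j, k' - k)"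
  have uv: "(i, j, k) + v = (i', j', k')" using u' by (simp add: v_def)
  let ?m = "Poly_Mapping.single v 1 :: 'k poly3"
  have "?m \<in> homogeneous_poly3 (s - d)"
    unfolding v_def using u' deg by (intro homogeneous_poly3_single) (auto simp: of_nat_diff)
  from homogeneous_poly3_mult[OF f(1) this] have "f * ?m \<in> homogeneous_poly3 s" by simp
  moreover have "lin3 * (f * ?m) = ?m * (lin3 * f)" by (simp only: ac_simps)
  then have "lin3 * (f * ?m) \<in> monomial_span S"
    using monomial_span_mult[OF S f(2)] by (simp only:)
  ultimately have "f * ?m \<in> monomial_span S" by (rule inj)
  moreover have "(i', j', k') \<in> Poly_Mapping.keys (f * ?m)"
    using u(1) unfolding uv[symmetric] by (simp only: in_keys_iff lookup_times_single not_False_eq_True)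
  ultimately show False
    using u'(5) by (auto simp: monomial_span_def)
qed

text \<open>Raise the first coordinate, then the second, then the third, until the sum is \<open>t\<close>.\<close>
lemma nat_triple_between:
  fixes i j k i' j' k' t :: nat
  assumes "i \<le> i'" "j \<le> j'" "k \<le> k'" "i + j + k \<le> t" "t \<le> i' + j' + k'"
  shows "\<exists>x y z. i \<le> x \<and> x \<le> i' \<and> j \<le> y \<and> y \<le> j' \<and> k \<le> z \<and> z \<le> k' \<and> x + y + z = t"
proof -
  consider "t \<le> i' + j + k" | "i' + j + k < t" "t \<le> i' + j' + k" | "i' + j' + k < t"
    by linarith
  then show ?thesis
  proof cases
    case 1
    show ?thesis
      by (rule exI[of _ "t - (j + k)"], rule exI[of _ j], rule exI[of _ k]) (use assms 1 in auto)
  next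
    case 2
    show ?thesis
      by (rule exI[of _ i'], rule exI[of _ "t - (i' + k)"], rule exI[of _ k]) (use assms 2 in auto)
  next
    case 3
    show ?thesis
      by (rule exI[of _ i'], rule exI[of _ j'], rule exI[of _ "t - (i' + j')"]) (use assms 3 in auto)
  qed
qed

text \<open>Put \<open>a = q + n\<close>, \<open>b = p + n\<close>, \<open>c = p + q\<close>. A monomial outside the ideal divides one of \<open>x\<^sup>\<alpha>\<^sup>-\<^sup>1 y\<^sup>b\<^sup>-\<^sup>1 z\<^sup>c\<^sup>-\<^sup>1\<close>,
  \<open>x\<^sup>a\<^sup>-\<^sup>1 y\<^sup>\<beta>\<^sup>-\<^sup>1 z\<^sup>c\<^sup>-\<^sup>1\<close>, \<open>x\<^sup>a\<^sup>-\<^sup>1 y\<^sup>b\<^sup>-\<^sup>1 z\<^sup>\<gamma>\<^sup>-\<^sup>1\<close>. For \<open>\<alpha> > 0\<close> the first has degree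
  \<open>t + p + \<alpha> - 1 \<ge> t\<close>, and likewise for the others.\<close>
lemma aci_no_low_socle:
  fixes p q n :: nat
  assumes "\<alpha> + \<beta> + \<gamma> = p + q + n" "\<alpha> < q + n" "\<beta> < p + n" "\<gamma> < p + q"
    and u: "(i, j, k) \<notin> aci_exponents (q + n) (p + n) (p + q) \<alpha> \<beta> \<gamma>" (is "_ \<notin> ?S")
    and deg: "i + j + k \<le> t" "t + 2 = p + q + n"
  shows "\<exists>x y z. i \<le> x \<and> j \<le> y \<and> k \<le> z \<and> x + y + z = t \<and> (x, y, z) \<notin> ?S"
proof -
  have less: "i < q + n" "j < p + n" "k < p + q" and or: "i < \<alpha> \<or> j < \<beta> \<or> k < \<gamma>"
    using u by (auto simp: aci_exponents_def ci_exponents_def)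
  have "\<exists>i' j' k'. i \<le> i' \<and> j \<le> j' \<and> k \<le> k' \<and> t \<le> i' + j' + k'
      \<and> i' < q + n \<and> j' < p + n \<and> k' < p + q \<and> (i' < \<alpha> \<or> j' < \<beta> \<or> k' < \<gamma>)"
    using or
  proof (elim disjE)
    assume "i < \<alpha>"
    show ?thesis
      by (rule exI[of _ "\<alpha> - 1"], rule exI[of _ "p + n - 1"], rule exI[of _ "p + q - 1"])
        (use assms(1-4) deg less \<open>i < \<alpha>\<close> in auto)
  next
    assume "j < \<beta>"
    show ?thesis
      by (rule exI[of _ "q + n - 1"], rule exI[of _ "\<beta> - 1"], rule exI[of _ "p + q - 1"])
        (use assms(1-4) deg less \<open>j < \<beta>\<close> in auto)
  next
    assume "k < \<gamma>"
    show ?thesis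
      by (rule exI[of _ "q + n - 1"], rule exI[of _ "p + n - 1"], rule exI[of _ "\<gamma> - 1"])
        (use assms(1-4) deg less \<open>k < \<gamma>\<close> in auto)
  qed
  then obtain i' j' k' where *: "i \<le> i'" "j \<le> j'" "k \<le> k'" "t \<le> i' + j' + k'"
    "i' < q + n" "j' < p + n" "k' < p + q" "i' < \<alpha> \<or> j' < \<beta> \<or> k' < \<gamma>" by blast
  with nat_triple_between[OF *(1-3) deg(1) *(4)] obtain x y z where
    "i \<le> x" "x \<le> i'" "j \<le> y" "y \<le> j'" "k \<le> z" "z \<le> k'" "x + y + z = t" by blast
  with * show ?thesis
    unfolding aci_exponents_def ci_exponents_def
    by - (rule exI[of _ x], rule exI[of _ y], rule exI[of _ z], auto)
qed

text \<open>The generator \<open>x\<^sup>\<alpha> y\<^sup>\<beta> z\<^sup>\<gamma>\<close> has degree \<open>s + 2\<close>, so in the degrees \<open>s\<close> and \<open>s + 1\<close> the algebra agrees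
  with the complete intersection, where the map is bijective. Surjectivity then propagates
  upwards, and injectivity downwards because there is no socle below degree \<open>s\<close>.\<close>
theorem weak_lefschetz_almost_ci:
  fixes p q n \<alpha> \<beta> \<gamma> :: nat
  assumes sum: "\<alpha> + \<beta> + \<gamma> = p + q + n" and less: "\<alpha> < q + n" "\<beta> < p + n" "\<gamma> < p + q"
    and two: "2 \<le> p + q + n"
    and det: "(of_int (det (toeplitz_binom_mat n (p + q) p)) :: 'k::field) \<noteq> 0"
    and I: "I = (almost_ci_ideal (q + n) (p + n) (p + q) \<alpha> \<beta> \<gamma> :: 'k poly3 set)"
  shows "weak_lefschetz (poly3_ring Quot I) (quot_component I)"
proof -
  define s where "s = int (p + q + n) - 2"
  let ?S = "ci_exponents (q + n) (p + n) (p + q)"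
  let ?T = "aci_exponents (q + n) (p + n) (p + q) \<alpha> \<beta> \<gamma>"
  have T: "up_closed ?T" by (rule up_closed_exponents)
  have IT: "I = monomial_span ?T" unfolding I by (rule almost_ci_ideal_eq_monomial_span)
  have surj_S: "homogeneous_poly3 (s + 1) \<subseteq> (lefschetz_image ?S s :: 'k poly3 set)"
  proof -
    have "0 < p + q + n" "int (p + q + n) - 1 = s + 1"
      using two unfolding s_def by linarith+
    with ci_middle_surjective[OF det] show ?thesis
      unfolding s_def[symmetric] by (simp only:)
  qed
  then have surj_T: "homogeneous_poly3 (s + 1) \<subseteq> (lefschetz_image ?T (s + 1 - 1) :: 'k poly3 set)"
    using lefschetz_image_mono[of ?S ?T] by (force simp: aci_exponents_def)
  have inj_T: "f \<in> monomial_span ?T" if f: "f \<in> homogeneous_poly3 s" "lin3 * f \<in> monomial_span ?T" for f :: "'k poly3"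
  proof -
    have "lin3 * f \<in> homogeneous_poly3 (1 + s)"
      by (rule homogeneous_poly3_mult[OF lin3_homogeneous f(1)])
    \<comment> \<open>No monomial of degree \<open>s + 1\<close> is a multiple of \<open>x\<^sup>\<alpha> y\<^sup>\<beta> z\<^sup>\<gamma>\<close>.\<close>
    then have "Poly_Mapping.keys (lin3 * f) \<inter> ?T \<subseteq> ?S"
      using sum by (fastforce simp: homogeneous_poly3_def aci_exponents_def s_def)
    then have "lin3 * f \<in> monomial_span ?S"
      using f(2) by (auto simp: monomial_span_def)
    then have "f \<in> monomial_span ?S"
      by (rule ci_middle_injective[OF f(1) _ _ surj_S]) (simp add: s_def)
    then show ?thesis
      using monomial_span_mono[of ?S ?T] by (auto simp: aci_exponents_def)
  qed
  show ?thesis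
  proof (rule weak_lefschetz_quotientI[where l = lin3])
    show "ideal I poly3_ring" unfolding IT by (rule ideal_monomial_span[OF T])
    show "lin3 \<in> homogeneous_poly3 1" by (rule lin3_homogeneous)
    fix d :: int
    show "(\<forall>f\<in>homogeneous_poly3 d. lin3 * f \<in> I \<longrightarrow> f \<in> I) \<or>
        (\<forall>g\<in>homogeneous_poly3 (d + 1). \<exists>f\<in>homogeneous_poly3 d. g - lin3 * f \<in> I)"
    proof (cases "d \<le> s")
      case True
      have "\<exists>i' j' k'. i \<le> i' \<and> j \<le> j' \<and> k \<le> k' \<and> int (i' + j' + k') = s \<and> (i', j', k') \<notin> ?T"
        if "(i, j, k) \<notin> ?T" "int (i + j + k) \<le> s" for i j k
        using aci_no_low_socle[OF sum less that(1), of "nat s"] that(2) two by (fastforce simp: s_def)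
      from lefschetz_injective_below[OF T inj_T this True] show ?thesis
        unfolding IT by blast
    next
      case False
      then have "homogeneous_poly3 (d + 1) \<subseteq> (lefschetz_image ?T d :: 'k poly3 set)"
        using lefschetz_surjective_above[OF T _ _ surj_T, of "d + 1"] two by (simp add: s_def)
      then show ?thesis
        unfolding IT lefschetz_image_def by blast
    qed
  qed
qed

theorem proposition6p4:
  fixes a b c \<alpha> \<beta> \<gamma> s A B C M :: int
    and I :: "'k::field poly3 set"
  assumes "0 \<le> \<alpha>" "\<alpha> < a" "0 \<le> \<beta>" "\<beta> < b" "0 \<le> \<gamma>" "\<gamma> < c"
    and "\<not> (\<alpha> = 0 \<and> \<beta> = 0)" "\<not> (\<alpha> = 0 \<and> \<gamma> = 0)" "\<not> (\<beta> = 0 \<and> \<gamma> = 0)"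
    and "3 dvd a + b + c + \<alpha> + \<beta> + \<gamma>"
    and "s = (a + b + c + \<alpha> + \<beta> + \<gamma>) div 3 - 2"
    and "A = s + 2 - a" "B = s + 2 - b" "C = s + 2 - c" "M = s + 2 - (\<alpha> + \<beta> + \<gamma>)"
    and "0 \<le> M" "0 \<le> A" "A \<le> \<beta> + \<gamma>" "0 \<le> B" "B \<le> \<alpha> + \<gamma>" "0 \<le> C" "C \<le> \<alpha> + \<beta>"
    and "a + b + c = 2 * (\<alpha> + \<beta> + \<gamma>)"
    and "I = almost_ci_ideal (nat a) (nat b) (nat c) (nat \<alpha>) (nat \<beta>) (nat \<gamma>)"
  shows "M = 0 \<and>
    of_int (det (N_mat a b c \<alpha> \<beta> \<gamma>)) = Mac (nat A) (nat B) (nat C) \<and>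
    A + B + C = \<alpha> + \<beta> + \<gamma> \<and> 2 * (A + B + C) = a + b + c \<and>
    (infinite (UNIV :: 'k set) \<and> (CHAR('k) = 0 \<or> A + B + C \<le> int CHAR('k)) \<longrightarrow>
       weak_lefschetz (poly3_ring Quot I) (quot_component I))"
proof -
  define p q n where "p = nat A" and "q = nat B" and "n = nat C"
  have sum: "a + b + c = 2 * \<alpha> + 2 * \<beta> + 2 * \<gamma>"
    using assms(23) by simp
  then have "a + b + c + \<alpha> + \<beta> + \<gamma> = 3 * (\<alpha> + \<beta> + \<gamma>)"
    by simp
  then have s: "s = \<alpha> + \<beta> + \<gamma> - 2"
    unfolding assms(11) by simp
  have M: "M = 0" and abc: "a = B + C" "b = A + C" "c = A + B"
    and ABC: "A + B + C = \<alpha> + \<beta> + \<gamma>"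
    using s assms(12-15) sum by linarith+
  have nats: "A = int p" "B = int q" "C = int n"
    using assms(17,19,21) unfolding p_def q_def n_def by linarith+
  have N: "N_mat a b c \<alpha> \<beta> \<gamma> = toeplitz_binom_mat n (p + q) p"
  proof -
    have "nat (int n + M) = n" "c = int (p + q)"
      using M nats abc by simp_all
    then show ?thesis
      unfolding N_mat_def Let_def toeplitz_binom_mat_def assms(11)[symmetric]
        assms(12,14,15)[symmetric] nats
      by (intro cong_mat) simp_all
  qed
  have "of_int (det (N_mat a b c \<alpha> \<beta> \<gamma>)) = Mac p q n"
    unfolding N by (rule det_toeplitz_binom_mat_eq_Mac)
  moreover have "weak_lefschetz (poly3_ring Quot I) (quot_component I)"
    if "CHAR('k) = 0 \<or> A + B + C \<le> int CHAR('k)"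
  proof (rule weak_lefschetz_almost_ci)
    show "nat \<alpha> + nat \<beta> + nat \<gamma> = p + q + n" "nat \<alpha> < q + n" "nat \<beta> < p + n" "nat \<gamma> < p + q"
      using assms(1-6) ABC abc nats by linarith+
    show "2 \<le> p + q + n"
      using assms(1-9) ABC nats by linarith
    show "(of_int (det (toeplitz_binom_mat n (p + q) p)) :: 'k) \<noteq> 0"
      using that nats by (intro det_toeplitz_binom_mat_neq_0) auto
    have "nat a = q + n" "nat b = p + n" "nat c = p + q"
      using abc nats by auto
    then show "I = almost_ci_ideal (q + n) (p + n) (p + q) (nat \<alpha>) (nat \<beta>) (nat \<gamma>)"
      using assms(24) by simp
  qed
  ultimately show ?thesis
    using M ABC assms(23) by (auto simp: p_def q_def n_def)
qed

end
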